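(* Consider the linear system $\dot{x}=A(t)x$, where $A:[0,+\infty)\to M(n,\mathbb{R})$, with evolution operator $\Phi(t,s)$. The system $\dot{x}=A(t)x$ has a nonuniform contraction if and only if it admits a strict Lyapunov function.
   Context: $M(n,\mathbb{R})$ denotes the real $n\times n$ matrices; $A$ is such that the evolution operator $\Phi(t,s)$ of $\dot x=A(t)x$ is defined for $t,s\ge 0$ (so $x(t)=\Phi(t,s)x(s)$ for every solution). Nonuniform contraction: there exist $K>0$, $\alpha>0$ and $\mu\ge 0$ such that $\|\Phi(t,s)\|\le K\exp(-\alpha(t-s)+\mu s)$ for all $t\ge s\ge 0$. Strict Lyapunov function: given $\mathcal{K}\ge 1$ and $\upsilon\ge 0$, a continuous function $V:[0,+\infty)\times X\to[0,+\infty)$ (with $X=\mathbb{R}^n$) is a strict Lyapunov function for $\dot x=A(t)x$ if (V1) $\|x\|^2\le V(t,x)\le \mathcal{K}^2\exp(2\upsilon t)\|x\|^2$ for all $t\ge 0$, $x\in X$; (V2) $V(t,\Phi(t,s)x)\le V(s,x)$ for all $t\ge s\ge 0$, $x\in X$; (V3) there exists $\gamma>0$ such that $V(t,\Phi(t,s)x)\le \exp(-2\gamma(t-s))V(s,x)$ for all $t\ge s\ge 0$, $x\in X$. The system admits a strict Lyapunov function if such a $V$ exists for some $\mathcal{K}\ge 1$ and $\upsilon\ge 0$. No differentiability of $V$ is required. *)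

theory Defs
  imports "HOL-Analysis.Analysis"
begin

(* Solutions of x' = A(t) x on [0, infinity), in integrated form with the Henstock-Kurzweil
   integral.  No regularity of A is prescribed, and this form covers both everywhere
   differentiable solutions (see the lemma below) and Caratheodory solutions, i.e. locally
   absolutely continuous x satisfying the equation almost everywhere.  Continuity of x on
   [0, infinity) is implied.  Values at negative times are irrelevant. *)
definition solution :: "(real \<Rightarrow> real^'n^'n) \<Rightarrow> (real \<Rightarrow> real^'n) \<Rightarrow> bool" where
  "solution A x \<longleftrightarrow>
    (\<forall>s t. 0 \<le> s \<and> s \<le> t \<longrightarrow> ((\<lambda>\<tau>. A \<tau> *v x \<tau>) has_integral (x t - x s)) {s..t})"

lemma solution_if_has_vector_derivative:
  assumes "\<And>t. 0 \<le> t \<Longrightarrow> (x has_vector_derivative A t *v x t) (at t within {0..})"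
  shows "solution A x"
  unfolding solution_def
proof (intro allI impI)
  fix s t :: real
  assume "0 \<le> s \<and> s \<le> t"
  then show "((\<lambda>\<tau>. A \<tau> *v x \<tau>) has_integral (x t - x s)) {s..t}"
    by (intro fundamental_theorem_of_calculus)
       (auto intro: has_vector_derivative_within_subset[OF assms])
qed

definition evolution_operator ::
  "(real \<Rightarrow> real^'n^'n) \<Rightarrow> (real \<Rightarrow> real \<Rightarrow> real^'n^'n) \<Rightarrow> bool" where
  "evolution_operator A \<Phi> \<longleftrightarrow>
    (\<forall>s\<ge>0. \<Phi> s s = mat 1 \<and> (\<forall>\<xi>. solution A (\<lambda>t. \<Phi> t s *v \<xi>))) \<and>
    (\<forall>x. solution A x \<longrightarrow> (\<forall>t\<ge>0. \<forall>s\<ge>0. x t = \<Phi> t s *v x s))"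

(* The matrix norm is the operator norm; norm on real^'n^'n would be the Frobenius norm. *)
definition nonuniform_contraction :: "(real \<Rightarrow> real \<Rightarrow> real^'n^'n) \<Rightarrow> bool" where
  "nonuniform_contraction \<Phi> \<longleftrightarrow>
    (\<exists>K \<alpha> \<mu>. K > 0 \<and> \<alpha> > 0 \<and> \<mu> \<ge> 0 \<and>
      (\<forall>t s. 0 \<le> s \<and> s \<le> t \<longrightarrow>
        onorm (\<lambda>x. \<Phi> t s *v x) \<le> K * exp (- \<alpha> * (t - s) + \<mu> * s)))"

definition strict_lyapunov_function ::
  "(real \<Rightarrow> real \<Rightarrow> real^'n^'n) \<Rightarrow> real \<Rightarrow> real \<Rightarrow> (real \<Rightarrow> real^'n \<Rightarrow> real) \<Rightarrow> bool" where
  "strict_lyapunov_function \<Phi> \<K> \<upsilon> V \<longleftrightarrow>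
    continuous_on ({0..} \<times> UNIV) (\<lambda>(t, x). V t x) \<and>
    (\<forall>t\<ge>0. \<forall>x. 0 \<le> V t x) \<and>
    (\<forall>t\<ge>0. \<forall>x. (norm x)\<^sup>2 \<le> V t x \<and> V t x \<le> \<K>\<^sup>2 * exp (2 * \<upsilon> * t) * (norm x)\<^sup>2) \<and>
    (\<forall>t s x. 0 \<le> s \<and> s \<le> t \<longrightarrow> V t (\<Phi> t s *v x) \<le> V s x) \<and>
    (\<exists>\<gamma>>0. \<forall>t s x. 0 \<le> s \<and> s \<le> t \<longrightarrow>
      V t (\<Phi> t s *v x) \<le> exp (- 2 * \<gamma> * (t - s)) * V s x)"

definition admits_strict_lyapunov_function :: "(real \<Rightarrow> real \<Rightarrow> real^'n^'n) \<Rightarrow> bool" where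
  "admits_strict_lyapunov_function \<Phi> \<longleftrightarrow>
    (\<exists>\<K> \<upsilon> V. \<K> \<ge> 1 \<and> \<upsilon> \<ge> 0 \<and> strict_lyapunov_function \<Phi> \<K> \<upsilon> V)"

end

theory Submission imports Defs begin

text \<open>
  A strict Lyapunov function \<open>V\<close> dominates the squared norm at time \<open>t\<close>, decays
  exponentially along solutions, and is dominated by a multiple of the squared norm at time
  \<open>s\<close>.  Chaining these three facts and taking square roots gives a nonuniform contraction
  (lemma \<open>strict_lyapunov_function_imp_contraction\<close>).

  Conversely, the exponential rate \<open>\<alpha>\<close> of a contraction is absorbed into a weighted supremum
  over the future, as in
    \<open>V t x = (SUP \<tau>\<ge>t. |\<Phi>(\<tau>,t) x| exp(\<alpha> (\<tau> - t)))\<^sup>2\<close>.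
  The point \<open>\<tau> = t\<close> gives the lower bound of \<open>V\<close> by the squared norm, the contraction
  estimate gives the upper bound, and moving forward along a solution shrinks the range of the supremum and shifts the
  weight, which is exponential decay with \<open>\<gamma> = \<alpha>\<close>.

  The delicate point is joint continuity of \<open>V\<close>, because \<open>t\<close> enters in the range of the
  supremum, in the weight and in the evolution operator.  Writing \<open>\<Phi>(\<tau>,t) x = \<Phi>(\<tau>,0) y\<close> with
  \<open>y = \<Phi>(0,t) x\<close> separates these roles:
    \<open>V t x = exp(-2 \<alpha> t) (G t y)\<^sup>2\<close>,  \<open>G t y = (SUP \<tau>\<ge>t. |\<Phi>(\<tau>,0) y| exp(\<alpha> \<tau>))\<close>.
  In \<open>t\<close>, the function \<open>G\<close> is the tail supremum of one fixed continuous function, hence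
  continuous (lemma \<open>continuous_on_tail_supremum\<close>).  In \<open>y\<close> it is Lipschitz with a constant
  independent of \<open>t\<close>: the nonuniform factor \<open>exp(\<mu> s)\<close> is \<open>1\<close> at initial time \<open>s = 0\<close>.  Finally,
  \<open>\<Phi>(0,t) x\<close> is jointly continuous in \<open>(t, x)\<close>, since it solves a linear system with the
  continuous coefficient matrix \<open>\<Phi>(t,0)\<close> and Cramer's rule applies
  (lemma \<open>continuous_on_linear_system_solution\<close>).
\<close>

section \<open>Tail suprema\<close>

text \<open>
  Moving the left end of the tail from \<open>s\<close> to a later \<open>t\<close> discards only values on \<open>{s..t}\<close>.  If
  \<open>h\<close> varies by less than \<open>\<epsilon>\<close> there, these exceed \<open>h t\<close>, and so the supremum from \<open>t\<close> on, by less
  than \<open>\<epsilon>\<close>.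
\<close>

lemma continuous_on_tail_supremum:
  fixes h :: "real \<Rightarrow> real"
  assumes cont: "continuous_on {a..} h" and bdd: "bdd_above (h ` {a..})"
  shows "continuous_on {a..} (\<lambda>t. SUP \<tau>\<in>{t..}. h \<tau>)"
  unfolding continuous_on_iff
proof (intro ballI allI impI)
  let ?T = "\<lambda>t. SUP \<tau>\<in>{t..}. h \<tau>"
  have bdd_tail: "bdd_above (h ` {t..})" if "a \<le> t" for t
    using bdd by (rule bdd_above_mono) (use that in auto)
  have upper: "h \<tau> \<le> ?T t" if "a \<le> t" "t \<le> \<tau>" for t \<tau>
    using that bdd_tail by (intro cSUP_upper) auto
  fix t0 e :: real
  assume t0: "t0 \<in> {a..}" and e: "0 < e"
  obtain d where d: "d > 0"
    and close: "\<And>\<tau>. a \<le> \<tau> \<Longrightarrow> dist \<tau> t0 < d \<Longrightarrow> dist (h \<tau>) (h t0) < e / 4"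
    using cont t0 e unfolding continuous_on_iff by (metis atLeast_iff divide_pos_pos zero_less_numeral)
  have osc: "\<bar>?T s - ?T t\<bar> \<le> e / 2"
    if "a \<le> s" "s \<le> t" "dist s t0 < d" "dist t t0 < d" for s t
  proof -
    have "?T s \<le> ?T t + e / 2"
    proof (rule cSUP_least)
      fix \<tau> assume \<tau>: "\<tau> \<in> {s..}"
      show "h \<tau> \<le> ?T t + e / 2"
      proof (cases "t \<le> \<tau>")
        case True
        then show ?thesis using upper[of t \<tau>] that e by simp
      next
        case False
        then have "dist \<tau> t0 < d" using \<tau> that by (auto simp: dist_real_def)
        then have "dist (h \<tau>) (h t0) < e / 4" "dist (h t) (h t0) < e / 4"
          using close \<tau> that by auto
        then have "h \<tau> \<le> h t + e / 2" unfolding dist_real_def by linarith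
        then show ?thesis using upper[of t t] that by simp
      qed
    qed simp
    moreover have "?T t \<le> ?T s"
      using that by (intro cSUP_least) (auto intro: upper)
    ultimately show ?thesis by simp
  qed
  show "\<exists>d>0. \<forall>t\<in>{a..}. dist t t0 < d \<longrightarrow> dist (?T t) (?T t0) < e"
  proof (intro exI[of _ d] conjI ballI impI)
    fix t assume "t \<in> {a..}" "dist t t0 < d"
    then have "\<bar>?T t - ?T t0\<bar> \<le> e / 2"
      using osc[of t t0] osc[of t0 t] t0 d by (cases "t \<le> t0") (auto simp: abs_minus_commute)
    then show "dist (?T t) (?T t0) < e" using e by (simp add: dist_real_def)
  qed (fact d)
qed

text \<open>
  A supremum is nonexpansive for the sup-distance, so a Lipschitz bound that is uniform in \<open>\<tau>\<close>
  passes to the tail supremum.  Together with continuity in \<open>t\<close> this yields joint continuity.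
\<close>

lemma continuous_on_parametric_tail_supremum:
  fixes g :: "real \<Rightarrow> 'a::metric_space \<Rightarrow> real"
  assumes cont: "\<And>y. continuous_on {a..} (\<lambda>\<tau>. g \<tau> y)"
    and bdd: "\<And>y. bdd_above ((\<lambda>\<tau>. g \<tau> y) ` {a..})"
    and lip: "\<And>\<tau> y z. a \<le> \<tau> \<Longrightarrow> g \<tau> y \<le> g \<tau> z + L * dist y z"
    and L: "0 \<le> L"
  shows "continuous_on ({a..} \<times> UNIV) (\<lambda>(t, y). SUP \<tau>\<in>{t..}. g \<tau> y)"
proof (rule continuous_on_TimesI)
  let ?G = "\<lambda>t y. SUP \<tau>\<in>{t..}. g \<tau> y"
  have le: "?G t y \<le> ?G t z + L * dist y z" if "a \<le> t" for t y z
  proof (rule cSUP_least)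
    fix \<tau> assume \<tau>: "\<tau> \<in> {t..}"
    have "bdd_above ((\<lambda>\<tau>. g \<tau> z) ` {t..})"
      using bdd[of z] by (rule bdd_above_mono) (use that in auto)
    then have "g \<tau> z \<le> ?G t z" using \<tau> by (intro cSUP_upper)
    then show "g \<tau> y \<le> ?G t z + L * dist y z"
      using lip[of \<tau> y z] \<tau> that by auto
  qed simp
  have "L-lipschitz_on B (?G t)" if "a \<le> t" for t B
  proof (rule lipschitz_onI)
    show "dist (?G t y) (?G t z) \<le> L * dist y z" for y z
      using le[OF that, of y z] le[OF that, of z y]
      by (simp add: dist_real_def abs_le_iff dist_commute[of z y])
  qed (fact L)
  then show "local_lipschitz {a..} UNIV ?G"
    unfolding local_lipschitz_def
    by (intro ballI exI[of _ "1::real"] exI[of _ L] conjI) auto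
qed (use cont bdd continuous_on_tail_supremum in blast)

section \<open>Linear equations with continuous coefficients\<close>

text \<open>Cramer's rule exhibits the solution as a quotient of polynomials in the data.\<close>

lemma continuous_on_linear_system_solution:
  fixes M :: "'a::topological_space \<Rightarrow> real^'n^'n" and b x :: "'a \<Rightarrow> real^'n"
  assumes M: "continuous_on S M" and b: "continuous_on S b"
    and inv: "\<And>p. p \<in> S \<Longrightarrow> invertible (M p)"
    and eq: "\<And>p. p \<in> S \<Longrightarrow> M p *v x p = b p"
  shows "continuous_on S x"
proof -
  have det: "det (M p) \<noteq> 0" if "p \<in> S" for p
    using inv[OF that] by (simp add: invertible_det_nz)
  have entry: "continuous_on S (\<lambda>p. if j = k then b p $ i else M p $ i $ j)" for i j k
    using M b by (cases "j = k") (auto intro!: continuous_intros)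
  have "continuous_on S (\<lambda>p. \<chi> k. det (\<chi> i j. if j = k then b p $ i else M p $ i $ j) / det (M p))"
    unfolding det_def using det entry M
    by (intro continuous_intros) (auto simp: det_def intro!: continuous_intros)
  then show ?thesis
    by (rule continuous_on_eq) (use cramer[OF det, THEN iffD1, OF _ eq] in simp)
qed

section \<open>From Lyapunov functions to contractions\<close>

lemma strict_lyapunov_function_imp_contraction:
  fixes \<Phi> :: "real \<Rightarrow> real \<Rightarrow> real^'n^'n"
  assumes V: "strict_lyapunov_function \<Phi> \<K> \<upsilon> V" and \<K>: "\<K> \<ge> 1" and \<upsilon>: "\<upsilon> \<ge> 0"
  shows "nonuniform_contraction \<Phi>"
proof -
  obtain \<gamma> where \<gamma>: "\<gamma> > 0"
    and decay: "\<And>t s x. 0 \<le> s \<Longrightarrow> s \<le> t \<Longrightarrow> V t (\<Phi> t s *v x) \<le> exp (- 2 * \<gamma> * (t - s)) * V s x"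
  proof -
    have "\<exists>\<gamma>>0. \<forall>t s x. 0 \<le> s \<and> s \<le> t \<longrightarrow>
        V t (\<Phi> t s *v x) \<le> exp (- 2 * \<gamma> * (t - s)) * V s x"
      using V unfolding strict_lyapunov_function_def by (elim conjE)
    then show thesis using that by blast
  qed
  have lower: "(norm x)\<^sup>2 \<le> V t x" and upper: "V t x \<le> \<K>\<^sup>2 * exp (2 * \<upsilon> * t) * (norm x)\<^sup>2"
    if "0 \<le> t" for t x
    using V that by (simp_all add: strict_lyapunov_function_def)
  have "onorm (\<lambda>x. \<Phi> t s *v x) \<le> \<K> * exp (- \<gamma> * (t - s) + \<upsilon> * s)"
    if st: "0 \<le> s" "s \<le> t" for s t
  proof (rule onorm_bound)
    fix x
    have "(norm (\<Phi> t s *v x))\<^sup>2 \<le> V t (\<Phi> t s *v x)" using st by (intro lower) simp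
    also have "\<dots> \<le> exp (- 2 * \<gamma> * (t - s)) * V s x" using st by (rule decay)
    also have "\<dots> \<le> exp (- 2 * \<gamma> * (t - s)) * (\<K>\<^sup>2 * exp (2 * \<upsilon> * s) * (norm x)\<^sup>2)"
      using st by (intro mult_left_mono upper) auto
    also have "\<dots> = (\<K> * exp (- \<gamma> * (t - s) + \<upsilon> * s) * norm x)\<^sup>2"
      by (simp add: power_mult_distrib exp_double[symmetric] exp_add[symmetric] algebra_simps)
    finally show "norm (\<Phi> t s *v x) \<le> \<K> * exp (- \<gamma> * (t - s) + \<upsilon> * s) * norm x"
      by (rule power2_le_imp_le) (use \<K> in simp)
  qed (use \<K> in simp)
  then show ?thesis
    unfolding nonuniform_contraction_def using \<K> \<upsilon> \<gamma>
    by (intro exI[of _ \<K>] exI[of _ \<gamma>] exI[of _ \<upsilon>]) auto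
qed

section \<open>Evolution operators\<close>

lemma solution_continuous_on:
  assumes "solution A x"
  shows "continuous_on {0..} x"
  unfolding continuous_on_eq_continuous_within
proof
  fix t :: real assume t: "t \<in> {0..}"
  define b where "b = t + 1"
  have int: "((\<lambda>\<tau>. A \<tau> *v x \<tau>) has_integral (x r - x 0)) {0..r}" if "0 \<le> r" for r
    using assms that unfolding solution_def by simp
  have "continuous_on {0..b} (\<lambda>r. x 0 + integral {0..r} (\<lambda>\<tau>. A \<tau> *v x \<tau>))"
    using int[of b] t unfolding b_def
    by (intro continuous_intros indefinite_integral_continuous_1) auto
  then have "continuous_on {0..b} x"
    by (rule continuous_on_eq) (use integral_unique[OF int] in auto)
  then have "continuous (at t within {0..b}) x"
    using t by (simp add: continuous_on_eq_continuous_within b_def)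
  moreover have "at t within {0..} = at t within {0..b}"
    by (rule at_within_nhd[of t "{..<b}"]) (auto simp: b_def)
  ultimately show "continuous (at t within {0..}) x" by simp
qed

context
  fixes A :: "real \<Rightarrow> real^'n^'n" and \<Phi> :: "real \<Rightarrow> real \<Rightarrow> real^'n^'n"
  assumes evol: "evolution_operator A \<Phi>"
begin

lemma evolution_refl: "0 \<le> s \<Longrightarrow> \<Phi> s s = mat 1"
  using evol by (simp add: evolution_operator_def)

lemma evolution_solution: "0 \<le> s \<Longrightarrow> solution A (\<lambda>t. \<Phi> t s *v x)"
  using evol by (simp add: evolution_operator_def)

text \<open>
  The times need not be ordered: every solution is recovered from its value at any time
  \<open>s\<close>, also at times before \<open>s\<close>.
\<close>

lemma evolution_cocycle:
  assumes "0 \<le> r" "0 \<le> s" "0 \<le> t"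
  shows "\<Phi> t s *v (\<Phi> s r *v x) = \<Phi> t r *v x"
proof -
  have "x t = \<Phi> t s *v x s" if "solution A x" for x
    using evol that assms(2,3) by (simp add: evolution_operator_def)
  from this[OF evolution_solution[OF assms(1)]] show ?thesis by simp
qed

lemma evolution_inverse:
  assumes "0 \<le> s" "0 \<le> t"
  shows "\<Phi> t s *v (\<Phi> s t *v x) = x"
  using evolution_cocycle[of t s t x] evolution_refl[of t] assms by simp

lemma invertible_evolution:
  assumes "0 \<le> s" "0 \<le> t"
  shows "invertible (\<Phi> t s)"
proof -
  have "\<Phi> s t ** \<Phi> t s = mat 1"
    using assms by (simp add: matrix_eq matrix_vector_mul_assoc[symmetric] evolution_inverse)
  then show ?thesis unfolding invertible_left_inverse by blast
qed

lemma continuous_on_evolution_vector: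
  assumes "0 \<le> s"
  shows "continuous_on {0..} (\<lambda>t. \<Phi> t s *v x)"
  by (rule solution_continuous_on[OF evolution_solution[OF assms]])

lemma continuous_on_evolution:
  assumes "0 \<le> s"
  shows "continuous_on {0..} (\<lambda>t. \<Phi> t s)"
proof -
  have "continuous_on {0..} (\<lambda>t. \<chi> i j. (\<Phi> t s *v axis j 1) $ i)"
    using continuous_on_evolution_vector[OF assms] by (intro continuous_intros)
  also have "(\<lambda>t. \<chi> i j. (\<Phi> t s *v axis j 1) $ i) = (\<lambda>t. \<Phi> t s)"
    by (simp add: fun_eq_iff vec_eq_iff matrix_vector_mult_basis column_def)
  finally show ?thesis .
qed

text \<open>
  Regularity in the first time argument comes from the differential equation; in the second one
  it is obtained by inverting \<open>\<Phi> t s\<close>.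
\<close>

lemma continuous_on_evolution_backward:
  assumes "0 \<le> s"
  shows "continuous_on ({0..} \<times> UNIV) (\<lambda>(t, x). \<Phi> s t *v x)"
proof (rule continuous_on_linear_system_solution)
  show "continuous_on ({0..} \<times> UNIV) (\<lambda>p. \<Phi> (fst p) s)"
    by (rule continuous_on_compose2[OF continuous_on_evolution[OF assms]])
       (auto intro!: continuous_intros)
  show "continuous_on ({0..} \<times> UNIV) (snd :: real \<times> (real^'n) \<Rightarrow> real^'n)"
    by (intro continuous_intros)
qed (use assms in \<open>auto simp: evolution_inverse invertible_evolution\<close>)

section \<open>From contractions to Lyapunov functions\<close>

lemma contraction_imp_strict_lyapunov_function:
  assumes "nonuniform_contraction \<Phi>"
  shows "admits_strict_lyapunov_function \<Phi>"
proof -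
  obtain K \<alpha> \<mu> where K: "K > 0" and \<alpha>: "\<alpha> > 0" and \<mu>: "\<mu> \<ge> 0"
    and onorm_le: "\<And>t s. 0 \<le> s \<Longrightarrow> s \<le> t \<Longrightarrow>
      onorm (\<lambda>x. \<Phi> t s *v x) \<le> K * exp (- \<alpha> * (t - s) + \<mu> * s)"
    using assms unfolding nonuniform_contraction_def by blast
  define g where "g \<tau> y = norm (\<Phi> \<tau> 0 *v y) * exp (\<alpha> * \<tau>)" for \<tau> y
  define G where "G t y = (SUP \<tau>\<in>{t..}. g \<tau> y)" for t y
  define V where "V t x = exp (- 2 * \<alpha> * t) * (G t (\<Phi> 0 t *v x))\<^sup>2" for t x

  have contr: "norm (\<Phi> t s *v x) \<le> K * exp (- \<alpha> * (t - s) + \<mu> * s) * norm x"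
    if "0 \<le> s" "s \<le> t" for s t x
    by (rule order_trans[OF onorm[OF matrix_vector_mul_bounded_linear]])
       (intro mult_right_mono onorm_le that norm_ge_zero)
  \<comment> \<open>\<open>G\<close> is taken over the orbit written in its value at time \<open>0\<close>; the cocycle identity turns
    this back into the orbit starting at time \<open>t\<close>, to which the contraction applies.\<close>
  have g_pullback: "g \<tau> (\<Phi> 0 t *v x) \<le> K * exp ((\<alpha> + \<mu>) * t) * norm x"
    if "0 \<le> t" "t \<le> \<tau>" for \<tau> t x
  proof -
    have "g \<tau> (\<Phi> 0 t *v x) = norm (\<Phi> \<tau> t *v x) * exp (\<alpha> * \<tau>)"
      using that by (simp add: g_def evolution_cocycle)
    also have "\<dots> \<le> (K * exp (- \<alpha> * (\<tau> - t) + \<mu> * t) * norm x) * exp (\<alpha> * \<tau>)"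
      using that by (intro mult_right_mono contr) auto
    also have "\<dots> = K * exp ((\<alpha> + \<mu>) * t) * norm x"
      by (simp add: exp_add[symmetric] algebra_simps)
    finally show ?thesis .
  qed
  have g_le: "g \<tau> y \<le> K * norm y" if "0 \<le> \<tau>" for \<tau> y
    using g_pullback[of 0 \<tau> y] that by (simp add: evolution_refl)
  have g_bdd: "bdd_above ((\<lambda>\<tau>. g \<tau> y) ` {t..})" if "0 \<le> t" for t y
    using g_le that by (intro bdd_aboveI2[of _ _ "K * norm y"]) auto
  have g_lip: "g \<tau> y \<le> g \<tau> z + K * dist y z" if "0 \<le> \<tau>" for \<tau> y z
  proof -
    have "norm (\<Phi> \<tau> 0 *v y) \<le> norm (\<Phi> \<tau> 0 *v z) + norm (\<Phi> \<tau> 0 *v (y - z))"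
      by (metis add.commute diff_add_cancel matrix_vector_mult_diff_distrib norm_triangle_ineq)
    then have "g \<tau> y \<le> (norm (\<Phi> \<tau> 0 *v z) + norm (\<Phi> \<tau> 0 *v (y - z))) * exp (\<alpha> * \<tau>)"
      unfolding g_def by (intro mult_right_mono) auto
    also have "\<dots> = g \<tau> z + g \<tau> (y - z)" unfolding g_def by (simp add: algebra_simps)
    finally show ?thesis using g_le[OF that, of "y - z"] by (simp add: dist_norm)
  qed
  have g_cont: "continuous_on {0..} (\<lambda>\<tau>. g \<tau> y)" for y
    unfolding g_def by (intro continuous_intros continuous_on_evolution_vector) simp
  have G_upper: "g \<tau> y \<le> G t y" if "0 \<le> t" "t \<le> \<tau>" for t \<tau> y
    unfolding G_def using that by (intro cSUP_upper g_bdd) auto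
  have G_nonneg: "0 \<le> G t y" if "0 \<le> t" for t y
    using G_upper[OF that order_refl, of y] by (rule order_trans[rotated]) (simp add: g_def)
  have G_antimono: "G t y \<le> G s y" if "0 \<le> s" "s \<le> t" for s t y
    unfolding G_def[of t] using that by (intro cSUP_least) (auto intro: G_upper)

  have "continuous_on ({0..} \<times> UNIV) (\<lambda>(t, y). G t y)"
    unfolding G_def using g_cont g_bdd g_lip K
    by (intro continuous_on_parametric_tail_supremum[where L = K]) auto
  then have "continuous_on ({0..} \<times> UNIV)
      (\<lambda>p. case (fst p, \<Phi> 0 (fst p) *v snd p) of (t, y) \<Rightarrow> G t y)"
    by (rule continuous_on_compose2)
       (use continuous_on_evolution_backward[of 0] in
         \<open>auto intro!: continuous_intros simp: case_prod_unfold\<close>)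
  then have V_cont: "continuous_on ({0..} \<times> UNIV) (\<lambda>(t, x). V t x)"
    unfolding V_def case_prod_unfold by (auto intro!: continuous_intros)

  have V_lower: "(norm x)\<^sup>2 \<le> V t x" if t: "0 \<le> t" for t x
  proof -
    have "norm x * exp (\<alpha> * t) \<le> G t (\<Phi> 0 t *v x)"
      using G_upper[OF t order_refl, of "\<Phi> 0 t *v x"] t by (simp add: g_def evolution_inverse)
    then have "(norm x * exp (\<alpha> * t))\<^sup>2 \<le> (G t (\<Phi> 0 t *v x))\<^sup>2"
      by (intro power_mono) auto
    then have "exp (- 2 * \<alpha> * t) * (norm x * exp (\<alpha> * t))\<^sup>2 \<le> V t x"
      unfolding V_def by (intro mult_left_mono) auto
    then show ?thesis
      by (simp add: power_mult_distrib exp_double[symmetric] exp_minus field_simps)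
  qed
  have V_upper: "V t x \<le> K\<^sup>2 * exp (2 * \<mu> * t) * (norm x)\<^sup>2" if t: "0 \<le> t" for t x
  proof -
    have "G t (\<Phi> 0 t *v x) \<le> K * exp ((\<alpha> + \<mu>) * t) * norm x"
      unfolding G_def using g_pullback[OF t] by (intro cSUP_least) auto
    then have "(G t (\<Phi> 0 t *v x))\<^sup>2 \<le> (K * exp ((\<alpha> + \<mu>) * t) * norm x)\<^sup>2"
      using G_nonneg[OF t] by (intro power_mono)
    then have "V t x \<le> exp (- 2 * \<alpha> * t) * (K * exp ((\<alpha> + \<mu>) * t) * norm x)\<^sup>2"
      unfolding V_def by (intro mult_left_mono) auto
    also have "\<dots> = K\<^sup>2 * exp (2 * \<mu> * t) * (norm x)\<^sup>2"
      by (simp add: power_mult_distrib exp_double[symmetric] exp_add[symmetric] algebra_simps)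
    finally show ?thesis .
  qed
  have V_decay: "V t (\<Phi> t s *v x) \<le> exp (- 2 * \<alpha> * (t - s)) * V s x"
    if st: "0 \<le> s" "s \<le> t" for s t x
  proof -
    have "V t (\<Phi> t s *v x) = exp (- 2 * \<alpha> * t) * (G t (\<Phi> 0 s *v x))\<^sup>2"
      using st by (simp add: V_def evolution_cocycle)
    also have "\<dots> \<le> exp (- 2 * \<alpha> * t) * (G s (\<Phi> 0 s *v x))\<^sup>2"
      using st by (intro mult_left_mono power_mono G_antimono G_nonneg) auto
    also have "\<dots> = exp (- 2 * \<alpha> * (t - s)) * V s x"
      by (simp add: V_def exp_add[symmetric] algebra_simps)
    finally show ?thesis .
  qed
  have V_nonneg: "0 \<le> V t x" for t x by (simp add: V_def)
  have V_mono: "V t (\<Phi> t s *v x) \<le> V s x" if st: "0 \<le> s" "s \<le> t" for s t x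
  proof -
    have "exp (- 2 * \<alpha> * (t - s)) * V s x \<le> 1 * V s x"
      using st \<alpha> V_nonneg by (intro mult_right_mono) auto
    then show ?thesis using V_decay[OF st, of x] by simp
  qed
  \<comment> \<open>At \<open>s = t = 0\<close> the contraction estimate bounds the norm of the identity by \<open>K\<close>.\<close>
  have K1: "K \<ge> 1"
    using contr[of 0 0 "axis undefined 1"] by (simp add: evolution_refl norm_axis_1)
  have "strict_lyapunov_function \<Phi> K \<mu> V"
    unfolding strict_lyapunov_function_def
    using V_cont V_nonneg V_lower V_upper V_mono V_decay \<alpha> by auto
  then show ?thesis
    unfolding admits_strict_lyapunov_function_def using K1 \<mu> by blast
qed

end

section \<open>The equivalence\<close>

theorem theorem1:
  fixes A :: "real \<Rightarrow> real^'n^'n" and \<Phi> :: "real \<Rightarrow> real \<Rightarrow> real^'n^'n"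
  assumes "evolution_operator A \<Phi>"
  shows "nonuniform_contraction \<Phi> \<longleftrightarrow> admits_strict_lyapunov_function \<Phi>"
  using contraction_imp_strict_lyapunov_function[OF assms]
    strict_lyapunov_function_imp_contraction
  unfolding admits_strict_lyapunov_function_def by blast

end
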